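(* Let $(\mathcal{F},\psi,\mathcal{J})$ be a standardized two-Krein space, $t\in\mathcal{F}$, and let $BV$ denote the complex vector space of functions $[a,b]\to\mathcal{F}$ that are strongly of bounded $t$-variation over $[a,b]$. The map $\mathcal{N}_{BV}:BV\times BV\to[0,\infty)$ defined by $$\mathcal{N}_{BV}(f,g)=\mathcal{N}_{\mathcal{J}}(f(a),t)\,V_{a}^{b}(g,\mathcal{F},t)_{\mathcal{J}}+\mathcal{N}_{\mathcal{J}}(g(a),t)\,V_{a}^{b}(f,\mathcal{F},t)_{\mathcal{J}}$$ is a two-norm on $BV$.
   Context: A Krein space is a pair $(\mathcal{F},[\cdot,\cdot])$ where $\mathcal{F}$ is a complex vector space and $[\cdot,\cdot]$ is an indefinite inner product (a Hermitian sesquilinear form, linear in the first variable) admitting a direct sum decomposition $\mathcal{F}=\mathcal{F}^{+}\dot{+}\mathcal{F}^{-}$ into mutually $[\cdot,\cdot]$-orthogonal subspaces (a fundamental decomposition) such that $(\mathcal{F}^{+},[\cdot,\cdot])$ and $(\mathcal{F}^{-},-[\cdot,\cdot])$ are Hilbert spaces. Each $x\in\mathcal{F}$ is written $x=x^{+}+x^{-}$ with $x^{\pm}\in\mathcal{F}^{\pm}$; the fundamental symmetry is $\mathcal{J}x=x^{+}-x^{-}$; $\|x^{+}\|_{+}=\sqrt{[x^{+},x^{+}]}$, $\|x^{-}\|_{-}=\sqrt{-[x^{-},x^{-}]}$. A standardized two-Krein space $(\mathcal{F},\psi,\mathcal{J})$ is such a Krein space, of dimension at least $2$, equipped with $\psi(x,y,z)=[x^{+},y^{+}]\|z^{+}\|_{+}^{2}+[x^{-},y^{-}]\|z^{-}\|_{-}^{2}$.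 Its $\mathcal{J}$-two-norm is $\mathcal{N}_{\mathcal{J}}(x,y)=\sqrt{\psi(\mathcal{J}x,x,y)}$. Let $\mathcal{P}[a,b]$ be the set of finite partitions $a=x_0<x_1<\dots<x_n=b$ of the closed interval $[a,b]$. For $f:[a,b]\to\mathcal{F}$ the $t$-variation is $V_{a}^{b}(f,\mathcal{F},t)_{\mathcal{J}}=\sup_{P\in\mathcal{P}[a,b]}\sum_{i=1}^{n}\mathcal{N}_{\mathcal{J}}(f(x_i)-f(x_{i-1}),t)$, and $f$ is strongly of bounded $t$-variation if this is finite. A two-norm on a complex vector space $F$ of dimension at least $2$ (possibly infinite) is a function $\mathcal{N}:F\times F\to\mathbb{R}$ such that, for all $g,u,h\in F$ and $\alpha\in\mathbb{C}$: $\mathcal{N}(g,\alpha u)=|\alpha|\mathcal{N}(g,u)$; $\mathcal{N}(g,u+h)\le\mathcal{N}(g,u)+\mathcal{N}(g,h)$; $\mathcal{N}(g,u)=\mathcal{N}(u,g)$. *)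

theory Defs
  imports Complex_Main "HOL-Library.Extended_Real" "HOL-Library.Function_Algebras"
begin

text \<open>Inner products are linear in the first variable. The form is only required to be an
  inner product on the subspace \<open>S\<close>, which is complete in the induced norm.\<close>

locale hilbert_subspace = vector_space scale
  for scale :: "complex \<Rightarrow> 'v::ab_group_add \<Rightarrow> 'v" (infixr "*s" 75) +
  fixes ip :: "'v \<Rightarrow> 'v \<Rightarrow> complex" and S :: "'v set"
  assumes subspace_S: "subspace S"
    and ip_add_left: "\<lbrakk>x \<in> S; y \<in> S; z \<in> S\<rbrakk> \<Longrightarrow> ip (x + y) z = ip x z + ip y z"
    and ip_scale_left: "\<lbrakk>x \<in> S; y \<in> S\<rbrakk> \<Longrightarrow> ip (c *s x) y = c * ip x y"
    and ip_hermitian: "\<lbrakk>x \<in> S; y \<in> S\<rbrakk> \<Longrightarrow> ip y x = cnj (ip x y)"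
    and ip_pos: "\<lbrakk>x \<in> S; x \<noteq> 0\<rbrakk> \<Longrightarrow> 0 < Re (ip x x)"
    and complete_S: "\<And>X :: nat \<Rightarrow> 'v.
      \<lbrakk>range X \<subseteq> S;
       \<forall>e>0. \<exists>M. \<forall>m\<ge>M. \<forall>n\<ge>M. sqrt (Re (ip (X m - X n) (X m - X n))) < e\<rbrakk>
      \<Longrightarrow> \<exists>x\<in>S. (\<lambda>n. sqrt (Re (ip (X n - x) (X n - x)))) \<longlonglongrightarrow> 0"

text \<open>A Krein space together with a chosen fundamental decomposition; either summand may be
  trivial.\<close>

locale krein_space = vector_space scale
  for scale :: "complex \<Rightarrow> 'v::ab_group_add \<Rightarrow> 'v" (infixr "*s" 75) +
  fixes ip :: "'v \<Rightarrow> 'v \<Rightarrow> complex" and Fp Fm :: "'v set"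
  assumes form_add_left: "ip (x + y) z = ip x z + ip y z"
    and form_scale_left: "ip (c *s x) y = c * ip x y"
    and form_hermitian: "ip y x = cnj (ip x y)"
    and direct_sum: "\<exists>!(p, q). p \<in> Fp \<and> q \<in> Fm \<and> x = p + q"
    and orthogonal: "\<lbrakk>p \<in> Fp; q \<in> Fm\<rbrakk> \<Longrightarrow> ip p q = 0"
    and hilbert_pos: "hilbert_subspace scale ip Fp"
    and hilbert_neg: "hilbert_subspace scale (\<lambda>x y. - ip x y) Fm"
begin

definition pos_part :: "'v \<Rightarrow> 'v" where
  "pos_part x = (THE p. p \<in> Fp \<and> (\<exists>q\<in>Fm. x = p + q))"

definition neg_part :: "'v \<Rightarrow> 'v" where
  "neg_part x = (THE q. q \<in> Fm \<and> (\<exists>p\<in>Fp. x = p + q))"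

definition norm_pos :: "'v \<Rightarrow> real" where
  "norm_pos p = sqrt (Re (ip p p))"

definition norm_neg :: "'v \<Rightarrow> real" where
  "norm_neg q = sqrt (Re (- ip q q))"

end

locale standardized_two_krein_space = krein_space scale ip Fp Fm
  for scale :: "complex \<Rightarrow> 'v::ab_group_add \<Rightarrow> 'v" (infixr "*s" 75) and ip Fp Fm +
  fixes \<psi> :: "'v \<Rightarrow> 'v \<Rightarrow> 'v \<Rightarrow> complex" and J :: "'v \<Rightarrow> 'v"
  assumes dim_ge_2: "\<exists>B. card B = 2 \<and> independent B"
    and J_eq: "J x = pos_part x - neg_part x"
    and psi_eq: "\<psi> x y z =
      ip (pos_part x) (pos_part y) * of_real ((norm_pos (pos_part z))\<^sup>2)
      + ip (neg_part x) (neg_part y) * of_real ((norm_neg (neg_part z))\<^sup>2)"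

text \<open>\<open>\<psi> (J x) x y\<close> is a nonnegative real number, so that taking the real part loses nothing.\<close>

definition J_two_norm :: "('v \<Rightarrow> 'v \<Rightarrow> 'v \<Rightarrow> complex) \<Rightarrow> ('v \<Rightarrow> 'v) \<Rightarrow> 'v \<Rightarrow> 'v \<Rightarrow> real" where
  "J_two_norm \<psi> J x y = sqrt (Re (\<psi> (J x) x y))"

text \<open>A partition is given by its number \<open>n\<close> of subintervals and its points \<open>x 0 < \<dots> < x n\<close>;
  the values of \<open>x\<close> beyond \<open>n\<close> are irrelevant.\<close>

definition partitions :: "real \<Rightarrow> real \<Rightarrow> (nat \<times> (nat \<Rightarrow> real)) set" where
  "partitions a b = {(n, x). x 0 = a \<and> x n = b \<and> (\<forall>i\<in>{1..n}. x (i - 1) < x i)}"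

definition t_variation ::
  "('v::ab_group_add \<Rightarrow> 'v \<Rightarrow> 'v \<Rightarrow> complex) \<Rightarrow> ('v \<Rightarrow> 'v) \<Rightarrow> real \<Rightarrow> real \<Rightarrow> 'v
    \<Rightarrow> (real \<Rightarrow> 'v) \<Rightarrow> ereal" where
  "t_variation \<psi> J a b t f =
    (SUP (n, x) \<in> partitions a b.
       ereal (\<Sum>i=1..n. J_two_norm \<psi> J (f (x i) - f (x (i - 1))) t))"

text \<open>Functions on \<open>[a, b]\<close> are represented by their extension by \<open>0\<close> to the real line, so that
  they form a subspace of the space of all functions with the pointwise operations.\<close>

definition BV :: "('v::ab_group_add \<Rightarrow> 'v \<Rightarrow> 'v \<Rightarrow> complex) \<Rightarrow> ('v \<Rightarrow> 'v) \<Rightarrow> real \<Rightarrow> real \<Rightarrow> 'v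
    \<Rightarrow> (real \<Rightarrow> 'v) set" where
  "BV \<psi> J a b t =
    {f. (\<forall>x. x \<notin> {a..b} \<longrightarrow> f x = 0) \<and> \<bar>t_variation \<psi> J a b t f\<bar> \<noteq> \<infinity>}"

definition fun_scale :: "(complex \<Rightarrow> 'v \<Rightarrow> 'v) \<Rightarrow> complex \<Rightarrow> (real \<Rightarrow> 'v) \<Rightarrow> real \<Rightarrow> 'v" where
  "fun_scale scale c f = (\<lambda>x. scale c (f x))"

definition BV_two_norm ::
  "('v::ab_group_add \<Rightarrow> 'v \<Rightarrow> 'v \<Rightarrow> complex) \<Rightarrow> ('v \<Rightarrow> 'v) \<Rightarrow> real \<Rightarrow> real \<Rightarrow> 'v
    \<Rightarrow> (real \<Rightarrow> 'v) \<Rightarrow> (real \<Rightarrow> 'v) \<Rightarrow> real" where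
  "BV_two_norm \<psi> J a b t f g =
    J_two_norm \<psi> J (f a) t * real_of_ereal (t_variation \<psi> J a b t g)
    + J_two_norm \<psi> J (g a) t * real_of_ereal (t_variation \<psi> J a b t f)"

text \<open>The vector space carrying the two-norm is a subspace \<open>V\<close> of the ambient type.\<close>

locale two_norm = vector_space scale
  for scale :: "complex \<Rightarrow> 'w::ab_group_add \<Rightarrow> 'w" (infixr "*s" 75) +
  fixes V :: "'w set" and N :: "'w \<Rightarrow> 'w \<Rightarrow> real"
  assumes subspace_V: "subspace V"
    and dim_ge_2: "\<exists>B\<subseteq>V. card B = 2 \<and> independent B"
    and N_scale: "\<lbrakk>g \<in> V; u \<in> V\<rbrakk> \<Longrightarrow> N g (\<alpha> *s u) = cmod \<alpha> * N g u"
    and N_triangle: "\<lbrakk>g \<in> V; u \<in> V; h \<in> V\<rbrakk> \<Longrightarrow> N g (u + h) \<le> N g u + N g h"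
    and N_commute: "\<lbrakk>g \<in> V; u \<in> V\<rbrakk> \<Longrightarrow> N g u = N u g"

end

theory Submission
  imports Defs
begin

text \<open>Write \<open>x = p + q\<close> for the fundamental decomposition. Since \<open>J x = p - q\<close>, the \<open>J\<close>-two-norm
  satisfies \<open>\<N> (x, t)\<^sup>2 = (\<parallel>p\<parallel> \<parallel>t\<^sup>+\<parallel>)\<^sup>2 + (\<parallel>q\<parallel> \<parallel>t\<^sup>-\<parallel>)\<^sup>2\<close>: for fixed \<open>t\<close> it is the Euclidean norm of a
  pair of weighted Hilbert space norms, hence a seminorm in \<open>x\<close> (lemma \<open>seminorm_J_two_norm\<close>). It can
  fail to be a norm, because either weight may vanish.

  Everything else only uses that \<open>x \<mapsto> \<N> (x, t)\<close> is a seminorm \<open>p\<close>. The total variation with respect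
  to \<open>p\<close> is a supremum of seminorms and so is itself homogeneous and subadditive in the function;
  evaluation at \<open>a\<close> followed by \<open>p\<close> is a seminorm as well. Therefore
  \<open>p (f a) * V g + p (g a) * V f\<close>, a symmetrized product of two seminorms, is a two-norm wherever \<open>V\<close>
  is finite (lemma \<open>two_norm_variation\<close>). The constant functions embed the given space
  linearly into the functions of bounded variation, so the dimension stays at least \<open>2\<close>.\<close>

section \<open>Seminorms and total variation\<close>

definition variation :: "('v::ab_group_add \<Rightarrow> real) \<Rightarrow> real \<Rightarrow> real \<Rightarrow> (real \<Rightarrow> 'v) \<Rightarrow> ereal" where
  "variation p a b f =
    (SUP (n, x) \<in> partitions a b. ereal (\<Sum>i=1..n. p (f (x i) - f (x (i - 1)))))"

lemma variation_upper:
  "(n, x) \<in> partitions a b \<Longrightarrow>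
    ereal (\<Sum>i=1..n. p (f (x i) - f (x (i - 1)))) \<le> variation p a b f"
  unfolding variation_def by (rule SUP_upper2[where i = "(n, x)"]) auto

lemma variation_least:
  assumes "\<And>n x. (n, x) \<in> partitions a b \<Longrightarrow>
    ereal (\<Sum>i=1..n. p (f (x i) - f (x (i - 1)))) \<le> c"
  shows "variation p a b f \<le> c"
  unfolding variation_def using assms by (auto intro!: SUP_least)

lemma trivial_partition: "a < b \<Longrightarrow> (1, \<lambda>i. if i = 0 then a else b) \<in> partitions a b"
  by (auto simp: partitions_def)

definition bounded_variation ::
  "('v::ab_group_add \<Rightarrow> real) \<Rightarrow> real \<Rightarrow> real \<Rightarrow> (real \<Rightarrow> 'v) set" where
  "bounded_variation p a b =
    {f. (\<forall>x. x \<notin> {a..b} \<longrightarrow> f x = 0) \<and> \<bar>variation p a b f\<bar> \<noteq> \<infinity>}"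

definition variation_two_norm ::
  "('v::ab_group_add \<Rightarrow> real) \<Rightarrow> real \<Rightarrow> real \<Rightarrow> (real \<Rightarrow> 'v) \<Rightarrow> (real \<Rightarrow> 'v) \<Rightarrow> real" where
  "variation_two_norm p a b f g =
    p (f a) * real_of_ereal (variation p a b g) + p (g a) * real_of_ereal (variation p a b f)"

lemma vector_space_fun_scale: "vector_space scale \<Longrightarrow> vector_space (fun_scale scale)"
  unfolding vector_space_def fun_scale_def by (auto simp: fun_eq_iff)

locale seminorm = vector_space scale
  for scale :: "complex \<Rightarrow> 'v::ab_group_add \<Rightarrow> 'v" (infixr "*s" 75) +
  fixes p :: "'v \<Rightarrow> real"
  assumes seminorm_scale: "p (c *s x) = cmod c * p x"
    and seminorm_triangle: "p (x + y) \<le> p x + p y"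
begin

lemma seminorm_zero: "p 0 = 0"
  using seminorm_scale[of 0 0] by simp

text \<open>Halve \<open>0 = p (x - x) \<le> p x + p (- x) = 2 * p x\<close>.\<close>

lemma seminorm_nonneg: "0 \<le> p x"
proof -
  have "p (- x) = p x"
    using seminorm_scale[of "-1" x] by simp
  then show ?thesis
    using seminorm_triangle[of x "- x"] seminorm_zero by simp
qed

lemma variation_nonneg:
  assumes "a < b"
  shows "0 \<le> variation p a b f"
proof -
  have "0 \<le> p (f b - f a)"
    by (rule seminorm_nonneg)
  then show ?thesis
    using variation_upper[OF trivial_partition[OF assms], of p f]
    by (simp add: order_trans[rotated])
qed

lemma variation_add: "variation p a b (f + g) \<le> variation p a b f + variation p a b g"
proof (rule variation_least)
  fix n x
  assume P: "(n, x) \<in> partitions a b"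
  have step: "p ((f + g) u - (f + g) v) \<le> p (f u - f v) + p (g u - g v)" for u v
    using seminorm_triangle[of "f u - f v" "g u - g v"] by (simp add: algebra_simps)
  have "(\<Sum>i=1..n. p ((f + g) (x i) - (f + g) (x (i - 1))))
      \<le> (\<Sum>i=1..n. p (f (x i) - f (x (i - 1))) + p (g (x i) - g (x (i - 1))))"
    by (intro sum_mono step)
  then have "ereal (\<Sum>i=1..n. p ((f + g) (x i) - (f + g) (x (i - 1))))
      \<le> ereal (\<Sum>i=1..n. p (f (x i) - f (x (i - 1)))) + ereal (\<Sum>i=1..n. p (g (x i) - g (x (i - 1))))"
    by (simp add: sum.distrib)
  also have "\<dots> \<le> variation p a b f + variation p a b g"
    by (intro add_mono variation_upper P)
  finally show "ereal (\<Sum>i=1..n. p ((f + g) (x i) - (f + g) (x (i - 1))))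
      \<le> variation p a b f + variation p a b g" .
qed

lemma variation_scale:
  assumes "a < b"
  shows "variation p a b (fun_scale scale c f) = ereal (cmod c) * variation p a b f"
proof -
  have "variation p a b (fun_scale scale c f) = (SUP P\<in>partitions a b.
      ereal (cmod c) * (case P of (n, x) \<Rightarrow> ereal (\<Sum>i=1..n. p (f (x i) - f (x (i - 1))))))"
    unfolding variation_def
    by (intro SUP_cong)
      (auto simp: fun_scale_def sum_distrib_left seminorm_scale
        simp flip: scale_right_diff_distrib)
  also have "\<dots> = ereal (cmod c) * variation p a b f"
    unfolding variation_def using trivial_partition[OF assms]
    by (intro SUP_ereal_mult_left) (auto intro!: sum_nonneg seminorm_nonneg)
  finally show ?thesis .
qed

text \<open>Constancy is asked for on \<open>[a, b]\<close> only, because a function of bounded variation is encoded by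
  its extension by \<open>0\<close>, which may jump at the end points; partition points stay in \<open>[a, b]\<close>.\<close>

lemma variation_const:
  assumes "a < b" and "\<And>x. x \<in> {a..b} \<Longrightarrow> f x = v"
  shows "variation p a b f = 0"
proof (rule antisym)
  show "variation p a b f \<le> 0"
  proof (rule variation_least)
    fix n x
    assume P: "(n, x) \<in> partitions a b"
    have mono: "x i \<le> x j" if "i \<le> j" "j \<le> n" for i j
      using that
    proof (induction j)
      case (Suc j)
      have "x j < x (Suc j)"
        using P Suc.prems unfolding partitions_def by (auto dest!: bspec[where x = "Suc j"])
      then show ?case
        using Suc by (cases "i = Suc j") auto
    qed auto
    have "f (x i) = v" if "i \<le> n" for i
      using mono[of 0 i] mono[of i n] that P by (intro assms(2)) (auto simp: partitions_def)
    then have "(\<Sum>i=1..n. p (f (x i) - f (x (i - 1)))) = 0"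
      by (intro sum.neutral) (auto simp: seminorm_zero)
    then show "ereal (\<Sum>i=1..n. p (f (x i) - f (x (i - 1)))) \<le> 0"
      by simp
  qed
qed (rule variation_nonneg[OF assms(1)])

lemma variation_two_norm_nonneg: "a < b \<Longrightarrow> 0 \<le> variation_two_norm p a b f g"
  unfolding variation_two_norm_def
  by (intro add_nonneg_nonneg mult_nonneg_nonneg seminorm_nonneg real_of_ereal_pos variation_nonneg)

lemma subspace_bounded_variation:
  assumes "a < b"
  shows "module.subspace (fun_scale scale) (bounded_variation p a b)"
proof -
  interpret F: vector_space "fun_scale scale"
    by (rule vector_space_fun_scale) unfold_locales
  show ?thesis
  proof (rule F.subspaceI)
    show "0 \<in> bounded_variation p a b"
      using variation_const[OF assms, of 0 0] by (simp add: bounded_variation_def)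
  next
    fix f g
    assume f: "f \<in> bounded_variation p a b" and g: "g \<in> bounded_variation p a b"
    have "variation p a b f + variation p a b g \<noteq> \<infinity>"
      using f g by (auto simp: bounded_variation_def)
    then have "\<bar>variation p a b (f + g)\<bar> \<noteq> \<infinity>"
      using variation_add[of a b f g] variation_nonneg[OF assms, of "f + g"] by auto
    then show "f + g \<in> bounded_variation p a b"
      using f g by (simp add: bounded_variation_def)
  next
    fix c f
    assume "f \<in> bounded_variation p a b"
    then show "fun_scale scale c f \<in> bounded_variation p a b"
      using variation_scale[OF assms, of c f]
      by (auto simp: bounded_variation_def fun_scale_def)
  qed
qed

text \<open>Sending a vector to the function that is constant on \<open>[a, b]\<close> is linear and injective, and so
  transports an independent pair.\<close>

lemma bounded_variation_dim_ge_2: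
  assumes "a < b" and "card B = 2" and "independent B"
  shows "\<exists>C\<subseteq>bounded_variation p a b. card C = 2 \<and> \<not> module.dependent (fun_scale scale) C"
proof -
  interpret F: vector_space "fun_scale scale"
    by (rule vector_space_fun_scale) unfold_locales
  define const :: "'v \<Rightarrow> real \<Rightarrow> 'v" where "const v x = (if x \<in> {a..b} then v else 0)" for v x
  interpret L: Vector_Spaces.linear scale "fun_scale scale" const
    by unfold_locales (auto simp: const_def fun_scale_def fun_eq_iff)
  have inj: "inj const"
    using \<open>a < b\<close> by (intro injI) (auto simp: const_def fun_eq_iff dest!: spec[of _ a])
  have "const v \<in> bounded_variation p a b" for v
    using variation_const[OF \<open>a < b\<close>, of "const v" v] by (simp add: bounded_variation_def const_def)
  moreover have "card (const ` B) = 2"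
    using card_image[OF inj_on_subset[OF inj subset_UNIV], of B] \<open>card B = 2\<close> by simp
  moreover have "\<not> F.dependent (const ` B)"
    using L.independent_injective_image[OF \<open>independent B\<close>] inj_on_subset[OF inj subset_UNIV] by blast
  ultimately show ?thesis
    by (intro exI[of _ "const ` B"]) auto
qed

lemma two_norm_variation:
  assumes "a < b" and "card B = 2" and "independent B"
  shows "two_norm (fun_scale scale) (bounded_variation p a b) (variation_two_norm p a b)"
proof -
  interpret F: vector_space "fun_scale scale"
    by (rule vector_space_fun_scale) unfold_locales
  show ?thesis
  proof
    show "F.subspace (bounded_variation p a b)"
      by (rule subspace_bounded_variation[OF \<open>a < b\<close>])
    show "\<exists>C\<subseteq>bounded_variation p a b. card C = 2 \<and> \<not> F.dependent C"
      by (rule bounded_variation_dim_ge_2[OF assms])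
  next
    fix f g c
    have "p (fun_scale scale c g a) = cmod c * p (g a)"
      by (simp add: fun_scale_def seminorm_scale)
    then show "variation_two_norm p a b f (fun_scale scale c g) = cmod c * variation_two_norm p a b f g"
      by (simp add: variation_two_norm_def variation_scale[OF \<open>a < b\<close>] algebra_simps)
    show "variation_two_norm p a b f g = variation_two_norm p a b g f"
      by (simp add: variation_two_norm_def)
  next
    fix f g h
    assume mem: "f \<in> bounded_variation p a b" "g \<in> bounded_variation p a b"
      "h \<in> bounded_variation p a b"
    let ?V = "\<lambda>f. real_of_ereal (variation p a b f)"
    \<comment> \<open>As \<open>real_of_ereal \<infinity> = 0\<close>, passing to real variations is monotone and additive only because
      those of \<open>g\<close> and \<open>h\<close> are finite.\<close>
    have "?V (g + h) \<le> real_of_ereal (variation p a b g + variation p a b h)"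
      using mem by (intro real_of_ereal_positive_mono variation_nonneg variation_add \<open>a < b\<close>)
        (auto simp: bounded_variation_def)
    also have "\<dots> = ?V g + ?V h"
      using mem by (cases "variation p a b g"; cases "variation p a b h")
        (auto simp: bounded_variation_def)
    finally have "p (f a) * ?V (g + h) \<le> p (f a) * (?V g + ?V h)"
      by (intro mult_left_mono seminorm_nonneg)
    moreover have "p ((g + h) a) * ?V f \<le> (p (g a) + p (h a)) * ?V f"
      using seminorm_triangle[of "g a" "h a"]
      by (intro mult_right_mono real_of_ereal_pos variation_nonneg \<open>a < b\<close>) simp
    ultimately show "variation_two_norm p a b f (g + h)
        \<le> variation_two_norm p a b f g + variation_two_norm p a b f h"
      by (simp add: variation_two_norm_def algebra_simps)
  qed
qed

end

section \<open>The norm of a Hilbert subspace\<close>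

context hilbert_subspace
begin

lemma ip_self_nonneg: "x \<in> S \<Longrightarrow> 0 \<le> Re (ip x x)"
  using ip_pos[of x] ip_scale_left[of 0 0 0] subspace_0[OF subspace_S]
  by (cases "x = 0") (auto intro: less_imp_le)

lemma ip_add_self:
  assumes "x \<in> S" "y \<in> S"
  shows "Re (ip (x + y) (x + y)) = Re (ip x x) + 2 * Re (ip x y) + Re (ip y y)"
proof -
  have "ip x (x + y) = cnj (ip (x + y) x)" "ip y (x + y) = cnj (ip (x + y) y)"
    using assms subspace_add[OF subspace_S] by (auto intro: ip_hermitian)
  moreover have "Re (ip y x) = Re (ip x y)"
    using ip_hermitian[of x y] assms by simp
  ultimately show ?thesis
    using assms subspace_add[OF subspace_S] by (simp add: ip_add_left)
qed

lemma ip_scale_self: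
  assumes "x \<in> S"
  shows "ip (c *s x) (c *s x) = of_real ((cmod c)\<^sup>2) * ip x x"
proof -
  have cx: "c *s x \<in> S"
    by (rule subspace_scale[OF subspace_S assms])
  have "ip x (c *s x) = cnj (c * ip x x)"
    using ip_hermitian[OF cx assms] ip_scale_left[OF assms assms] by simp
  moreover have "cnj (ip x x) = ip x x"
    using ip_hermitian[OF assms assms] by simp
  ultimately show ?thesis
    using ip_scale_left[OF assms cx, of c] complex_norm_square[of c] by (simp add: mult_ac)
qed

text \<open>The Cauchy-Schwarz inequality for the real part: the vector
  \<open>[y, y] x - (Re [x, y]) y\<close>, a multiple of the component of \<open>x\<close> orthogonal to \<open>y\<close> over the reals,
  has nonnegative square.\<close>

lemma Re_ip_le:
  assumes x: "x \<in> S" and y: "y \<in> S"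
  shows "Re (ip x y) \<le> sqrt (Re (ip x x)) * sqrt (Re (ip y y))"
proof (cases "y = 0")
  case True
  have "ip 0 x = 0"
    using ip_scale_left[of 0 x 0] x subspace_0[OF subspace_S] by (metis mult_zero_left scale_zero_left)
  then have "ip x y = 0"
    using ip_hermitian[of 0 x] x subspace_0[OF subspace_S] True by simp
  then show ?thesis
    using ip_self_nonneg[OF x] ip_self_nonneg[OF y] by simp
next
  case False
  define A R C where "A = Re (ip x x)" and "R = Re (ip x y)" and "C = Re (ip y y)"
  have C: "0 < C"
    using ip_pos[OF y False] by (simp add: C_def)
  let ?u = "of_real C *s x" and ?v = "of_real (- R) *s y"
  have u: "?u \<in> S" and v: "?v \<in> S"
    by (rule subspace_scale[OF subspace_S x] subspace_scale[OF subspace_S y])+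
  have "ip x ?v = cnj (of_real (- R) * ip y x)"
    using ip_hermitian[OF v x] ip_scale_left[OF y x, of "of_real (- R)"] by simp
  then have "ip ?u ?v = of_real C * of_real (- R) * ip x y"
    using ip_scale_left[OF x v, of "of_real C"] ip_hermitian[OF x y] by simp
  then have "Re (ip ?u ?v) = - (C * R * R)"
    by (simp add: R_def)
  moreover have "Re (ip ?u ?u) = C\<^sup>2 * A" "Re (ip ?v ?v) = R\<^sup>2 * C"
    unfolding ip_scale_self[OF x] ip_scale_self[OF y] norm_of_real
    by (simp_all add: A_def C_def)
  ultimately have "0 \<le> C\<^sup>2 * A - 2 * (C * R * R) + R\<^sup>2 * C"
    using ip_self_nonneg[OF subspace_add[OF subspace_S u v]]
    unfolding ip_add_self[OF u v] by linarith
  also have "\<dots> = C * (A * C - R\<^sup>2)"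
    by (simp add: power2_eq_square algebra_simps)
  finally have "R\<^sup>2 \<le> A * C"
    using C by (simp add: zero_le_mult_iff)
  then show ?thesis
    by (metis A_def C_def R_def real_le_rsqrt real_sqrt_mult)
qed

lemma ip_norm_triangle:
  assumes "x \<in> S" "y \<in> S"
  shows "sqrt (Re (ip (x + y) (x + y))) \<le> sqrt (Re (ip x x)) + sqrt (Re (ip y y))"
proof (rule real_le_lsqrt)
  show "Re (ip (x + y) (x + y)) \<le> (sqrt (Re (ip x x)) + sqrt (Re (ip y y)))\<^sup>2"
    using ip_add_self[OF assms] Re_ip_le[OF assms] assms ip_self_nonneg
    by (simp add: power2_sum)
qed (use assms ip_self_nonneg in auto)

lemma ip_norm_scale:
  "x \<in> S \<Longrightarrow> sqrt (Re (ip (c *s x) (c *s x))) = cmod c * sqrt (Re (ip x x))"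
  by (simp add: ip_scale_self real_sqrt_mult)

end

section \<open>The two-norm of a standardized two-Krein space\<close>

context krein_space
begin

interpretation P: hilbert_subspace scale ip Fp
  by (rule hilbert_pos)

interpretation M: hilbert_subspace scale "\<lambda>x y. - ip x y" Fm
  by (rule hilbert_neg)

lemma decomposition_unique:
  assumes "p \<in> Fp" "q \<in> Fm" "p' \<in> Fp" "q' \<in> Fm" "p + q = p' + q'"
  shows "p = p' \<and> q = q'"
proof -
  obtain r where "\<And>s. (case s of (u, v) \<Rightarrow> u \<in> Fp \<and> v \<in> Fm \<and> p + q = u + v) \<Longrightarrow> s = r"
    using direct_sum[of "p + q"] by (auto elim!: ex1E)
  from this[of "(p, q)"] this[of "(p', q')"] show ?thesis
    using assms by auto
qed

lemma pos_part_eq: "p \<in> Fp \<Longrightarrow> q \<in> Fm \<Longrightarrow> pos_part (p + q) = p"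
  unfolding pos_part_def by (rule the_equality) (auto dest: decomposition_unique)

lemma neg_part_eq: "p \<in> Fp \<Longrightarrow> q \<in> Fm \<Longrightarrow> neg_part (p + q) = q"
  unfolding neg_part_def by (rule the_equality) (auto dest: decomposition_unique)

lemma decomposition:
  obtains p q where "p \<in> Fp" "q \<in> Fm" "x = p + q"
  using direct_sum[of x] by auto

lemma parts_mem: "pos_part x \<in> Fp" "neg_part x \<in> Fm"
  using decomposition[of x] by (metis pos_part_eq, metis neg_part_eq)

lemma parts_sum: "x = pos_part x + neg_part x"
  using decomposition[of x] by (metis pos_part_eq neg_part_eq)

lemma parts_add:
  "pos_part (x + y) = pos_part x + pos_part y" "neg_part (x + y) = neg_part x + neg_part y"
proof -
  have "x + y = (pos_part x + pos_part y) + (neg_part x + neg_part y)"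
    using parts_sum[of x] parts_sum[of y] by (metis add.assoc add.left_commute)
  then show "pos_part (x + y) = pos_part x + pos_part y" "neg_part (x + y) = neg_part x + neg_part y"
    by (metis pos_part_eq neg_part_eq parts_mem P.subspace_S M.subspace_S subspace_add)+
qed

lemma parts_scale: "pos_part (c *s x) = c *s pos_part x" "neg_part (c *s x) = c *s neg_part x"
proof -
  have "c *s x = c *s pos_part x + c *s neg_part x"
    using parts_sum[of x] by (metis scale_right_distrib)
  then show "pos_part (c *s x) = c *s pos_part x" "neg_part (c *s x) = c *s neg_part x"
    by (metis pos_part_eq neg_part_eq parts_mem P.subspace_S M.subspace_S subspace_scale)+
qed

lemma norm_pos_nonneg: "0 \<le> norm_pos (pos_part x)"
  unfolding norm_pos_def using P.ip_self_nonneg[OF parts_mem(1)] by simp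

lemma norm_neg_nonneg: "0 \<le> norm_neg (neg_part x)"
  unfolding norm_neg_def using M.ip_self_nonneg[OF parts_mem(2)] by simp

lemma norm_pos_triangle:
  "norm_pos (pos_part (x + y)) \<le> norm_pos (pos_part x) + norm_pos (pos_part y)"
  unfolding norm_pos_def parts_add by (rule P.ip_norm_triangle[OF parts_mem(1) parts_mem(1)])

lemma norm_neg_triangle:
  "norm_neg (neg_part (x + y)) \<le> norm_neg (neg_part x) + norm_neg (neg_part y)"
  unfolding norm_neg_def parts_add by (rule M.ip_norm_triangle[OF parts_mem(2) parts_mem(2)])

lemma norm_pos_scale: "norm_pos (pos_part (c *s x)) = cmod c * norm_pos (pos_part x)"
  unfolding norm_pos_def parts_scale by (rule P.ip_norm_scale[OF parts_mem(1)])

lemma norm_neg_scale: "norm_neg (neg_part (c *s x)) = cmod c * norm_neg (neg_part x)"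
  unfolding norm_neg_def parts_scale by (rule M.ip_norm_scale[OF parts_mem(2)])

end

context standardized_two_krein_space
begin

lemma parts_J: "pos_part (J x) = pos_part x" "neg_part (J x) = - neg_part x"
proof -
  have "- neg_part x \<in> Fm"
    using parts_mem(2) hilbert_subspace.subspace_S[OF hilbert_neg] by (intro subspace_neg)
  then show "pos_part (J x) = pos_part x" "neg_part (J x) = - neg_part x"
    using pos_part_eq[OF parts_mem(1)] neg_part_eq[OF parts_mem(1)]
    by (metis J_eq diff_conv_add_uminus)+
qed

text \<open>The sign that \<open>J\<close> puts on the negative part turns the negative definite form on \<open>Fm\<close> into its
  Hilbert space inner product.\<close>

lemma J_two_norm_eq:
  "J_two_norm \<psi> J x y =
    sqrt ((norm_pos (pos_part x) * norm_pos (pos_part y))\<^sup>2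
      + (norm_neg (neg_part x) * norm_neg (neg_part y))\<^sup>2)"
proof -
  have "ip (- neg_part x) (neg_part x) = - ip (neg_part x) (neg_part x)"
    using form_scale_left[of "-1" "neg_part x" "neg_part x"] by simp
  moreover have "(norm_pos (pos_part x))\<^sup>2 = Re (ip (pos_part x) (pos_part x))"
    using norm_pos_nonneg[of x] by (simp add: norm_pos_def)
  moreover have "(norm_neg (neg_part x))\<^sup>2 = - Re (ip (neg_part x) (neg_part x))"
    using norm_neg_nonneg[of x] by (simp add: norm_neg_def)
  ultimately show ?thesis
    by (simp add: J_two_norm_def psi_eq parts_J power_mult_distrib flip: of_real_power)
qed

lemma seminorm_J_two_norm: "seminorm scale (\<lambda>x. J_two_norm \<psi> J x t)"
proof
  fix c x
  show "J_two_norm \<psi> J (c *s x) t = cmod c * J_two_norm \<psi> J x t"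
    unfolding J_two_norm_eq norm_pos_scale norm_neg_scale
    by (simp add: real_sqrt_mult power_mult_distrib mult.assoc flip: distrib_left)
next
  fix x y
  let ?P = "\<lambda>x. norm_pos (pos_part x) * norm_pos (pos_part t)"
  let ?N = "\<lambda>x. norm_neg (neg_part x) * norm_neg (neg_part t)"
  have "?P (x + y) \<le> ?P x + ?P y" "?N (x + y) \<le> ?N x + ?N y"
    using mult_right_mono[OF norm_pos_triangle[of x y] norm_pos_nonneg[of t]]
      mult_right_mono[OF norm_neg_triangle[of x y] norm_neg_nonneg[of t]]
    by (simp_all add: distrib_right)
  then have "J_two_norm \<psi> J (x + y) t \<le> sqrt ((?P x + ?P y)\<^sup>2 + (?N x + ?N y)\<^sup>2)"
    unfolding J_two_norm_eq
    by (intro real_sqrt_le_mono add_mono power_mono mult_nonneg_nonneg norm_pos_nonneg norm_neg_nonneg)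
  also have "\<dots> \<le> J_two_norm \<psi> J x t + J_two_norm \<psi> J y t"
    unfolding J_two_norm_eq by (rule real_sqrt_sum_squares_triangle_ineq)
  finally show "J_two_norm \<psi> J (x + y) t \<le> J_two_norm \<psi> J x t + J_two_norm \<psi> J y t" .
qed

end

theorem theorem5p5:
  fixes scale :: "complex \<Rightarrow> 'v::ab_group_add \<Rightarrow> 'v"
    and ip :: "'v \<Rightarrow> 'v \<Rightarrow> complex"
    and Fp Fm :: "'v set"
    and \<psi> :: "'v \<Rightarrow> 'v \<Rightarrow> 'v \<Rightarrow> complex"
    and J :: "'v \<Rightarrow> 'v"
    and t :: 'v
    and a b :: real
  assumes "standardized_two_krein_space scale ip Fp Fm \<psi> J"
    and "a < b"
  shows "two_norm (fun_scale scale) (BV \<psi> J a b t) (BV_two_norm \<psi> J a b t)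
    \<and> (\<forall>f\<in>BV \<psi> J a b t. \<forall>g\<in>BV \<psi> J a b t. 0 \<le> BV_two_norm \<psi> J a b t f g)"
proof -
  interpret K: standardized_two_krein_space scale ip Fp Fm \<psi> J
    by (rule assms(1))
  define p where "p x = J_two_norm \<psi> J x t" for x
  interpret seminorm scale p
    unfolding p_def by (rule K.seminorm_J_two_norm)
  have var: "t_variation \<psi> J a b t = variation p a b"
    by (simp add: fun_eq_iff t_variation_def variation_def p_def)
  have BV: "BV \<psi> J a b t = bounded_variation p a b"
    by (simp add: BV_def bounded_variation_def var)
  have N: "BV_two_norm \<psi> J a b t = variation_two_norm p a b"
    by (simp add: fun_eq_iff BV_two_norm_def variation_two_norm_def var p_def)
  obtain B where "card B = 2" "\<not> K.dependent B"
    using K.dim_ge_2 by blast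
  then show ?thesis
    unfolding BV N using two_norm_variation variation_two_norm_nonneg \<open>a < b\<close> by blast
qed

end
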